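(* Let $0<q<1$. Given the left $\mathcal{A}(S^2_q)$-module isomorphisms $\mathcal{L}^{(0)}_n\simeq\mathcal{E}^{(0)}_n$ and $\mathcal{L}^{(1)}_n\simeq\mathcal{E}^{(1)}_n$ (both given by $\phi\mapsto\phi\langle\Psi^{(n)}|$), there is, for any associated line bundle $\mathcal{E}^{(0)}_n$, $n\in\mathbb{Z}$, an equivalence between the set of connections on the quantum Hopf bundle, given by projections $\Pi$ on $\Omega^1(SU_q(2))$ with $\Pi(\omega_\pm)=0$ and $\Pi(\omega_z)=\omega_z+U\omega_++V\omega_-$ ($U\in\mathcal{L}^{(0)}_2$, $V\in\mathcal{L}^{(0)}_{-2}$), and the set $C(\mathcal{E}^{(0)}_n)$ of covariant derivatives $\nabla$ on $\mathcal{E}^{(0)}_n$. With $\phi\in\mathcal{L}^{(0)}_n$, so that $\langle\sigma_\phi|=\phi\langle\Psi^{(n)}|\in\mathcal{E}^{(0)}_n$, the equivalence is given by $$D\phi=(\nabla\langle\sigma_\phi|)\,|\Psi^{(n)}\rangle ,$$ where $D\phi=(1-\Pi)\mathrm{d}\phi$.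
   Context: Let $0<q<1$. Algebra. $\mathcal{A}(SU_q(2))$ is the unital $*$-algebra generated by $a,c$ with $ac=qca$, $ac^*=qc^*a$, $cc^*=c^*c$, $a^*a+c^*c=aa^*+q^2cc^*=1$. The Hopf algebra $\mathcal{U}_q(\mathfrak{su}(2))$ generated by $K^{\pm1},E,F$, with coproduct $\Delta K^{\pm1}=K^{\pm1}\otimes K^{\pm1}$, $\Delta E=E\otimes K+K^{-1}\otimes E$, $\Delta F=F\otimes K+K^{-1}\otimes F$, acts on it from the left (with $X\triangleright(xy)=(X_{(1)}\triangleright x)(X_{(2)}\triangleright y)$, $X\triangleright 1=\varepsilon(X)1$, $\varepsilon(K)=1$, $\varepsilon(E)=\varepsilon(F)=0$) by $K\triangleright a=q^{-1/2}a$, $K\triangleright c=q^{-1/2}c$, $K\triangleright a^*=q^{1/2}a^*$, $K\triangleright c^*=q^{1/2}c^*$; $E\triangleright a=-qc^*$, $E\triangleright c=a^*$, $E\triangleright a^*=E\triangleright c^*=0$; $F\triangleright a^*=c$, $F\triangleright c^*=-q^{-1}a$, $F\triangleright a=F\triangleright c=0$. Put $\mathcal{L}^{(0)}_n=\{x: K\triangleright x=q^{n/2}x\}$ for $n\in\mathbb{Z}$, $\mathcal{A}(S^2_q)=\mathcal{L}^{(0)}_0$ (the standard Podleś sphere, base of the quantum Hopf bundle with total space algebra $\mathcal{A}(SU_q(2))$ and structure group algebra $\mathcal{A}(U(1))$), and $X_-=q^{-1/2}FK$, $X_+=q^{1/2}EK$, $X_z=(1-K^4)/(1-q^{-2})$.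 Calculus. $\Omega^1(SU_q(2))$ is the $\mathcal{A}(SU_q(2))$-bimodule of the left covariant 3D calculus of Woronowicz, free as a left module on $\omega_-,\omega_+,\omega_z$, with $\omega_z\phi=q^{2n}\phi\,\omega_z$, $\omega_\pm\phi=q^n\phi\,\omega_\pm$ for $\phi\in\mathcal{L}^{(0)}_n$, and differential $\mathrm{d}x=(X_+\triangleright x)\omega_++(X_-\triangleright x)\omega_-+(X_z\triangleright x)\omega_z$. The 1-forms on the base are $\Omega^1(S^2_q)=\mathcal{L}^{(0)}_{-2}\omega_-\oplus\mathcal{L}^{(0)}_2\omega_+$, and $\mathrm{d}$ maps $\mathcal{A}(S^2_q)$ to $\Omega^1(S^2_q)$. Line bundles. For $n\in\mathbb{Z}$ let $|\Psi^{(n)}\rangle$ be the column with entries, $\mu=0,\dots,|n|$: for $n\ge0$, $|\Psi^{(n)}\rangle_\mu=\sqrt{\beta_{n,\mu}}\,c^{*\mu}a^{*\,n-\mu}$ with $\beta_{n,0}=1$, $\beta_{n,\mu}=q^{2\mu}\prod_{j=0}^{\mu-1}\frac{1-q^{-2(n-j)}}{1-q^{-2(j+1)}}$; for $n\le0$, $|\Psi^{(n)}\rangle_\mu=\sqrt{\alpha_{n,\mu}}\,c^{|n|-\mu}a^{\mu}$ with $\alpha_{n,\mu}=\prod_{j=0}^{|n|-\mu-1}\frac{1-q^{2(|n|-j)}}{1-q^{2(j+1)}}$ (an empty product being 1). Its entries lie in $\mathcal{L}^{(0)}_n$; $\langle\Psi^{(n)}|$ is the row of adjoint entries; $\langle\Psi^{(n)}|\Psi^{(n)}\rangle=1$;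 $\mathfrak{p}^{(n)}=|\Psi^{(n)}\rangle\langle\Psi^{(n)}|$ is a projection with entries in $\mathcal{A}(S^2_q)$. Put $\mathcal{E}^{(0)}_n=\mathcal{A}(S^2_q)^{|n|+1}\mathfrak{p}^{(n)}$ (row vectors) and $\mathcal{E}^{(1)}_n=\Omega^1(S^2_q)\otimes_{\mathcal{A}(S^2_q)}\mathcal{E}^{(0)}_n$, identified with the rows $\langle\sigma|\in\Omega^1(S^2_q)^{|n|+1}$ satisfying $\langle\sigma|\mathfrak{p}^{(n)}=\langle\sigma|$. There are left $\mathcal{A}(S^2_q)$-module isomorphisms $\phi\mapsto\phi\langle\Psi^{(n)}|$, with inverse $\langle\sigma|\mapsto\langle\sigma|\Psi^{(n)}\rangle$, from $\mathcal{L}^{(0)}_n$ to $\mathcal{E}^{(0)}_n$, and from the horizontal coequivariant 1-forms $\mathcal{L}^{(1)}_n=\mathcal{L}^{(0)}_{n-2}\omega_-\oplus\mathcal{L}^{(0)}_{n+2}\omega_+$ to $\mathcal{E}^{(1)}_n$. Connections on the bundle. They are the left $\mathcal{A}(SU_q(2))$-linear projections $\Pi:\Omega^1(SU_q(2))\to\Omega^1(SU_q(2))$ with $\Pi(\omega_\pm)=0$, $\Pi(\omega_z)=\omega_z+\mathrm a$, where $\mathrm a=U\omega_++V\omega_-$ with $U\in\mathcal{L}^{(0)}_2$, $V\in\mathcal{L}^{(0)}_{-2}$ is an arbitrary element of $\Omega^1(S^2_q)$. Covariant derivatives. $C(\mathcal{E}^{(0)}_n)$ is the set of $\mathbb{C}$-linear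 maps $\nabla:\mathcal{E}^{(0)}_n\to\mathcal{E}^{(1)}_n$ with $\nabla(f\langle\sigma|)=\mathrm{d}f\,\langle\sigma|+f\nabla\langle\sigma|$ for $f\in\mathcal{A}(S^2_q)$ (each extends to form-valued sections by the left Leibniz rule and is determined by this restriction). Any such map can be written $\nabla\langle\sigma|=(\mathrm{d}\langle\sigma|)\mathfrak{p}^{(n)}+\langle\sigma|\mathrm{A}^{(n)}$ with gauge potential $\mathrm{A}^{(n)}$ an $(|n|+1)\times(|n|+1)$ matrix over $\Omega^1(S^2_q)$ satisfying $\mathrm{A}^{(n)}=\mathrm{A}^{(n)}\mathfrak{p}^{(n)}=\mathfrak{p}^{(n)}\mathrm{A}^{(n)}$.
   Formalization: The equivalence is proved to be a bijection exactly for n ≠ 0; for n = 0 the formula still assigns a covariant derivative to each connection, but Dφ = dφ for every Π, so distinct connections give the same ∇ and the claim as printed fails. *)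

theory Defs
  imports
    Complex_Main
    "HOL-Library.FuncSet"
    "HOL-Library.Poly_Mapping"
    "HOL-Library.Product_Plus"
begin

section \<open>The presentation of the algebra of quantum SU(2)\<close>

text \<open>The letters stand for $a, a^*, c, c^*$. Elements of the free unital algebra on them are
  finitely supported functions from words to complex numbers.\<close>

datatype letter = La | Las | Lc | Lcs

type_synonym ncpoly = "letter list \<Rightarrow>\<^sub>0 complex"

abbreviation ncmon :: "complex \<Rightarrow> letter list \<Rightarrow> ncpoly" where
  "ncmon k w \<equiv> Poly_Mapping.single w k"

text \<open>The defining relations, together with the adjoints of the first two (the other three are
  self-adjoint), so that the ideal they generate is a $*$-ideal.\<close>

definition relators :: "real \<Rightarrow> ncpoly set" where
  "relators q =
    {ncmon 1 [La, Lc] - ncmon q [Lc, La],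
     ncmon 1 [La, Lcs] - ncmon q [Lcs, La],
     ncmon 1 [Lcs, Las] - ncmon q [Las, Lcs],
     ncmon 1 [Lc, Las] - ncmon q [Las, Lc],
     ncmon 1 [Lc, Lcs] - ncmon 1 [Lcs, Lc],
     ncmon 1 [Las, La] + ncmon 1 [Lcs, Lc] - ncmon 1 [],
     ncmon 1 [La, Las] + ncmon (q\<^sup>2) [Lc, Lcs] - ncmon 1 []}"

text \<open>\<open>sandwich k u r v\<close> is the product $k\,u\,r\,v$ in the free algebra, for words \<open>u\<close>, \<open>v\<close>.\<close>

definition sandwich :: "complex \<Rightarrow> letter list \<Rightarrow> ncpoly \<Rightarrow> letter list \<Rightarrow> ncpoly" where
  "sandwich k u r v =
    (\<Sum>w\<in>Poly_Mapping.keys r. ncmon (k * Poly_Mapping.lookup r w) (u @ w @ v))"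

inductive_set relation_ideal :: "real \<Rightarrow> ncpoly set" for q :: real where
  zero: "0 \<in> relation_ideal q"
| step: "p \<in> relation_ideal q \<Longrightarrow> r \<in> relators q \<Longrightarrow> p + sandwich k u r v \<in> relation_ideal q"


section \<open>The algebra and the action of the quantum universal enveloping algebra\<close>

text \<open>The ring structure of the algebra is that of the type \<open>'a\<close>; the record holds
  the multiplication by complex scalars, the involution, the generators \<open>a\<close>, \<open>c\<close>, and the
  operators by which $K$, $K^{-1}$, $E$, $F$ act from the left.\<close>

record 'a suq2 =
  scl :: "complex \<Rightarrow> 'a \<Rightarrow> 'a"
  adj :: "'a \<Rightarrow> 'a"
  gen_a :: 'a
  gen_c :: 'a
  actK :: "'a \<Rightarrow> 'a"
  actKinv :: "'a \<Rightarrow> 'a"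
  actE :: "'a \<Rightarrow> 'a"
  actF :: "'a \<Rightarrow> 'a"

fun letter_val :: "('a::ring_1) suq2 \<Rightarrow> letter \<Rightarrow> 'a" where
  "letter_val S La = gen_a S"
| "letter_val S Las = adj S (gen_a S)"
| "letter_val S Lc = gen_c S"
| "letter_val S Lcs = adj S (gen_c S)"

definition nc_eval :: "('a::ring_1) suq2 \<Rightarrow> ncpoly \<Rightarrow> 'a" where
  "nc_eval S p =
    (\<Sum>w\<in>Poly_Mapping.keys p.
       scl S (Poly_Mapping.lookup p w) (prod_list (map (letter_val S) w)))"

text \<open>The last two assumptions say that the algebra is the quotient of the free algebra
  by the ideal of relations, i.e. that it is \<^emph>\<open>the\<close> unital $*$-algebra generated by
  \<open>a\<close>, \<open>c\<close> subject to the relations (unique up to isomorphism).\<close>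

locale algebra_SUq2 =
  fixes q :: real and S :: "('a::ring_1) suq2"
  assumes scl_vector_space: "vector_space (scl S)"
    and scl_mult_left: "scl S k x * y = scl S k (x * y)"
    and scl_mult_right: "x * scl S k y = scl S k (x * y)"
    and adj_add: "adj S (x + y) = adj S x + adj S y"
    and adj_scl: "adj S (scl S k x) = scl S (cnj k) (adj S x)"
    and adj_mult: "adj S (x * y) = adj S y * adj S x"
    and adj_adj: "adj S (adj S x) = x"
    and generated: "\<exists>p. nc_eval S p = x"
    and presented: "nc_eval S p = 0 \<longleftrightarrow> p \<in> relation_ideal q"

text \<open>The left action: each operator is linear, acts on products through the coproduct and on the
  unit through the counit, and has the prescribed values on the generators. These properties
  determine the four operators uniquely.\<close>

locale hopf_action_SUq2 = algebra_SUq2 q S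
  for q :: real and S :: "('a::ring_1) suq2" +
  assumes K_linear: "Vector_Spaces.linear (scl S) (scl S) (actK S)"
    and E_linear: "Vector_Spaces.linear (scl S) (scl S) (actE S)"
    and F_linear: "Vector_Spaces.linear (scl S) (scl S) (actF S)"
    and K_Kinv: "actK S (actKinv S x) = x"
    and Kinv_K: "actKinv S (actK S x) = x"
    and K_one: "actK S 1 = 1"
    and E_one: "actE S 1 = 0"
    and F_one: "actF S 1 = 0"
    and K_mult: "actK S (x * y) = actK S x * actK S y"
    and E_mult: "actE S (x * y) = actE S x * actK S y + actKinv S x * actE S y"
    and F_mult: "actF S (x * y) = actF S x * actK S y + actKinv S x * actF S y"
    and K_a: "actK S (gen_a S) = scl S (q powr (-1/2)) (gen_a S)"
    and K_c: "actK S (gen_c S) = scl S (q powr (-1/2)) (gen_c S)"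
    and K_a_adj: "actK S (adj S (gen_a S)) = scl S (q powr (1/2)) (adj S (gen_a S))"
    and K_c_adj: "actK S (adj S (gen_c S)) = scl S (q powr (1/2)) (adj S (gen_c S))"
    and E_a: "actE S (gen_a S) = scl S (- q) (adj S (gen_c S))"
    and E_c: "actE S (gen_c S) = adj S (gen_a S)"
    and E_a_adj: "actE S (adj S (gen_a S)) = 0"
    and E_c_adj: "actE S (adj S (gen_c S)) = 0"
    and F_a_adj: "actF S (adj S (gen_a S)) = gen_c S"
    and F_c_adj: "actF S (adj S (gen_c S)) = scl S (- inverse q) (gen_a S)"
    and F_a: "actF S (gen_a S) = 0"
    and F_c: "actF S (gen_c S) = 0"

definition line0 :: "real \<Rightarrow> ('a::ring_1) suq2 \<Rightarrow> int \<Rightarrow> 'a set" where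
  "line0 q S n = {x. actK S x = scl S (q powr (n / 2)) x}"

abbreviation podles_sphere :: "real \<Rightarrow> ('a::ring_1) suq2 \<Rightarrow> 'a set" where
  "podles_sphere q S \<equiv> line0 q S 0"

definition X_minus :: "real \<Rightarrow> ('a::ring_1) suq2 \<Rightarrow> 'a \<Rightarrow> 'a" where
  "X_minus q S x = scl S (q powr (-1/2)) (actF S (actK S x))"

definition X_plus :: "real \<Rightarrow> ('a::ring_1) suq2 \<Rightarrow> 'a \<Rightarrow> 'a" where
  "X_plus q S x = scl S (q powr (1/2)) (actE S (actK S x))"

definition X_z :: "real \<Rightarrow> ('a::ring_1) suq2 \<Rightarrow> 'a \<Rightarrow> 'a" where
  "X_z q S x = scl S (1 / (1 - q powi (-2))) (x - (actK S ^^ 4) x)"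


section \<open>The calculus\<close>

text \<open>The triple \<open>(u, v, w)\<close> is the form $u\,\omega_+ + v\,\omega_- + w\,\omega_z$.\<close>

type_synonym 'a form1 = "'a \<times> 'a \<times> 'a"

definition om_plus :: "('a::ring_1) form1" where "om_plus = (1, 0, 0)"
definition om_minus :: "('a::ring_1) form1" where "om_minus = (0, 1, 0)"
definition om_z :: "('a::ring_1) form1" where "om_z = (0, 0, 1)"

fun lmul :: "('a::ring_1) \<Rightarrow> 'a form1 \<Rightarrow> 'a form1" where
  "lmul x (u, v, w) = (x * u, x * v, x * w)"

fun scl_form :: "('a::ring_1) suq2 \<Rightarrow> complex \<Rightarrow> 'a form1 \<Rightarrow> 'a form1" where
  "scl_form S k (u, v, w) = (scl S k u, scl S k v, scl S k w)"

text \<open>On an element $\phi$ of degree $n$ the operator $K^2$ is multiplication by $q^n$ and $K^4$ is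
  multiplication by $q^{2n}$, so this is $\omega_\pm\phi = q^n\phi\,\omega_\pm$ and
  $\omega_z\phi = q^{2n}\phi\,\omega_z$, extended linearly to sums of homogeneous elements.\<close>

fun rmul :: "('a::ring_1) suq2 \<Rightarrow> 'a form1 \<Rightarrow> 'a \<Rightarrow> 'a form1" where
  "rmul S (u, v, w) x = (u * (actK S ^^ 2) x, v * (actK S ^^ 2) x, w * (actK S ^^ 4) x)"

definition d :: "real \<Rightarrow> ('a::ring_1) suq2 \<Rightarrow> 'a \<Rightarrow> 'a form1" where
  "d q S x = lmul (X_plus q S x) om_plus + lmul (X_minus q S x) om_minus + lmul (X_z q S x) om_z"

definition base_forms :: "real \<Rightarrow> ('a::ring_1) suq2 \<Rightarrow> 'a form1 set" where
  "base_forms q S = {lmul V om_minus + lmul U om_plus | U V. U \<in> line0 q S 2 \<and> V \<in> line0 q S (-2)}"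


section \<open>Line bundles\<close>

definition beta :: "real \<Rightarrow> int \<Rightarrow> nat \<Rightarrow> real" where
  "beta q n \<mu> = q ^ (2 * \<mu>) *
    (\<Prod>j<\<mu>. (1 - q powi (-2 * (n - int j))) / (1 - q powi (-2 * (int j + 1))))"

definition alpha :: "real \<Rightarrow> int \<Rightarrow> nat \<Rightarrow> real" where
  "alpha q n \<mu> =
    (\<Prod>j<nat \<bar>n\<bar> - \<mu>. (1 - q powi (2 * (\<bar>n\<bar> - int j))) / (1 - q powi (2 * (int j + 1))))"

text \<open>Columns and rows of length $|n|+1$ are functions on \<open>nat\<close> that vanish beyond \<open>nat \<bar>n\<bar>\<close>.\<close>

definition Psi :: "real \<Rightarrow> ('a::ring_1) suq2 \<Rightarrow> int \<Rightarrow> nat \<Rightarrow> 'a" where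
  "Psi q S n \<mu> =
    (if \<mu> > nat \<bar>n\<bar> then 0
     else if n \<ge> 0 then
       scl S (sqrt (beta q n \<mu>)) (adj S (gen_c S) ^ \<mu> * adj S (gen_a S) ^ (nat n - \<mu>))
     else scl S (sqrt (alpha q n \<mu>)) (gen_c S ^ (nat \<bar>n\<bar> - \<mu>) * gen_a S ^ \<mu>))"

definition proj :: "real \<Rightarrow> ('a::ring_1) suq2 \<Rightarrow> int \<Rightarrow> nat \<Rightarrow> nat \<Rightarrow> 'a" where
  "proj q S n \<mu> \<nu> = Psi q S n \<mu> * adj S (Psi q S n \<nu>)"

definition rows :: "int \<Rightarrow> ('b::zero) set \<Rightarrow> (nat \<Rightarrow> 'b) set" where
  "rows n X = {\<sigma>. (\<forall>\<mu>\<le>nat \<bar>n\<bar>. \<sigma> \<mu> \<in> X) \<and> (\<forall>\<mu>>nat \<bar>n\<bar>. \<sigma> \<mu> = 0)}"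

definition E0 :: "real \<Rightarrow> ('a::ring_1) suq2 \<Rightarrow> int \<Rightarrow> (nat \<Rightarrow> 'a) set" where
  "E0 q S n = {\<lambda>\<nu>. \<Sum>\<mu>\<le>nat \<bar>n\<bar>. v \<mu> * proj q S n \<mu> \<nu> | v. v \<in> rows n (podles_sphere q S)}"

definition E1 :: "real \<Rightarrow> ('a::ring_1) suq2 \<Rightarrow> int \<Rightarrow> (nat \<Rightarrow> 'a form1) set" where
  "E1 q S n = {\<sigma> \<in> rows n (base_forms q S).
    (\<lambda>\<nu>. \<Sum>\<mu>\<le>nat \<bar>n\<bar>. rmul S (\<sigma> \<mu>) (proj q S n \<mu> \<nu>)) = \<sigma>}"

text \<open>\<open>times_bra\<close> is $\phi \mapsto \phi\langle\Psi^{(n)}|$ and \<open>times_ket\<close> is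
  $\langle\sigma| \mapsto \langle\sigma|\Psi^{(n)}\rangle$ on rows of 1-forms.\<close>

definition times_bra :: "real \<Rightarrow> ('a::ring_1) suq2 \<Rightarrow> int \<Rightarrow> 'a \<Rightarrow> (nat \<Rightarrow> 'a)" where
  "times_bra q S n \<phi> = (\<lambda>\<mu>. \<phi> * adj S (Psi q S n \<mu>))"

definition times_ket :: "real \<Rightarrow> ('a::ring_1) suq2 \<Rightarrow> int \<Rightarrow> (nat \<Rightarrow> 'a form1) \<Rightarrow> 'a form1" where
  "times_ket q S n \<sigma> = (\<Sum>\<mu>\<le>nat \<bar>n\<bar>. rmul S (\<sigma> \<mu>) (Psi q S n \<mu>))"


section \<open>Connections and covariant derivatives\<close>

definition connections :: "real \<Rightarrow> ('a::ring_1) suq2 \<Rightarrow> ('a form1 \<Rightarrow> 'a form1) set" where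
  "connections q S = {P.
    (\<forall>\<eta> \<theta>. P (\<eta> + \<theta>) = P \<eta> + P \<theta>) \<and>
    (\<forall>x \<eta>. P (lmul x \<eta>) = lmul x (P \<eta>)) \<and>
    (\<forall>\<eta>. P (P \<eta>) = P \<eta>) \<and>
    P om_plus = 0 \<and> P om_minus = 0 \<and>
    (\<exists>U\<in>line0 q S 2. \<exists>V\<in>line0 q S (-2). P om_z = om_z + lmul U om_plus + lmul V om_minus)}"

definition D :: "real \<Rightarrow> ('a::ring_1) suq2 \<Rightarrow> ('a form1 \<Rightarrow> 'a form1) \<Rightarrow> 'a \<Rightarrow> 'a form1" where
  "D q S P \<phi> = d q S \<phi> - P (d q S \<phi>)"

text \<open>Since $K^4$ is the identity on degree $0$, \<open>X_z\<close> vanishes there, so on degree $0$ the map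
  \<open>D q S P\<close> is \<open>d q S\<close> whatever the connection \<open>P\<close>: for \<open>n = 0\<close> the assignment of covariant
  derivatives to connections is constant.\<close>

text \<open>Covariant derivatives are maps with domain \<open>E0 q S n\<close>; as HOL functions they are
  made extensional (undefined outside that set).\<close>

definition cov_derivs ::
    "real \<Rightarrow> ('a::ring_1) suq2 \<Rightarrow> int \<Rightarrow> ((nat \<Rightarrow> 'a) \<Rightarrow> (nat \<Rightarrow> 'a form1)) set" where
  "cov_derivs q S n = {N \<in> E0 q S n \<rightarrow>\<^sub>E E1 q S n.
    (\<forall>\<sigma>\<in>E0 q S n. \<forall>\<tau>\<in>E0 q S n. N (\<lambda>\<mu>. \<sigma> \<mu> + \<tau> \<mu>) = (\<lambda>\<mu>. N \<sigma> \<mu> + N \<tau> \<mu>)) \<and>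
    (\<forall>k. \<forall>\<sigma>\<in>E0 q S n. N (\<lambda>\<mu>. scl S k (\<sigma> \<mu>)) = (\<lambda>\<mu>. scl_form S k (N \<sigma> \<mu>))) \<and>
    (\<forall>f\<in>podles_sphere q S. \<forall>\<sigma>\<in>E0 q S n.
       N (\<lambda>\<mu>. f * \<sigma> \<mu>) = (\<lambda>\<mu>. rmul S (d q S f) (\<sigma> \<mu>) + lmul f (N \<sigma> \<mu>)))}"

end

theory Submission
  imports Defs
begin

text \<open>
A section $\phi$ of degree $n$ is vertically differentiated by $X_z$, and since $K^4$ is the scalar
$q^{2n}$ on degree $n$, this is multiplication by a scalar $\kappa_n$. Hence for the connection with
1-form $\mathrm{a}=U\omega_++V\omega_-$
$$D\phi = (X_+\phi)\,\omega_+ + (X_-\phi)\,\omega_- - \kappa_n\,\phi\,\mathrm{a},$$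
so that connections enter affinely, through right multiplication by $\mathrm{a}$
(\<open>D_connection_of\<close>, \<open>D_on_line\<close>).

Everything else is transport along $\phi\mapsto\phi\langle\Psi^{(n)}|$, which needs one fact about the
column $\Psi^{(n)}$, namely $\sum_\mu \Psi_\mu^*\Psi_\mu=1$ (\<open>Psi_normalized\<close>). This is a
$q$-binomial expansion of the sphere relation, proved once for both signs of $n$ in
\<open>qbinomial_resolution_of_one\<close>. It makes contraction with the ket and multiplication by the bra mutually
inverse, for functions and for forms, so $D$ yields a covariant derivative, and it is the only one that
satisfies the equation of the theorem (\<open>cov_deriv_of_in_cov_derivs\<close>, \<open>cov_deriv_of_eq_iff\<close>).

Conversely, two covariant derivatives differ by a map $M$ that is linear over the functions on the
sphere. The frame gives $M\phi=\phi\sum_\mu\Psi_\mu^*M\Psi_\mu$, that is, $M$ is right multiplication by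
a 1-form on the base (\<open>left_linear_is_multiplication\<close>). Since $\kappa_n\ne 0$ exactly for $n\ne 0$,
the form $\mathrm{a}$ can be solved for, uniquely, in every nonzero degree
(\<open>inj_on_cov_deriv_of\<close>, \<open>surj_cov_deriv_of\<close>). In degree $0$ the scalar $\kappa_0$ vanishes and all
connections, of which there are several, give the same derivative
(\<open>not_inj_on_cov_deriv_of_0\<close>).

The degrees of $X_\pm\phi$ rest on $KE=qEK$ and $KF=q^{-1}FK$. These hold because they hold on the
generators and pass to products (\<open>K_twisted_derivation\<close>).
\<close>


section \<open>The algebra and its relations\<close>

sublocale algebra_SUq2 \<subseteq> vs: vector_space "scl S"
  by (rule scl_vector_space)

context algebra_SUq2
begin

abbreviation rscl :: "real \<Rightarrow> 'a \<Rightarrow> 'a" (infixr "\<cdot>" 75) where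
  "r \<cdot> x \<equiv> scl S (complex_of_real r) x"

abbreviation word_val :: "letter list \<Rightarrow> 'a" where
  "word_val w \<equiv> prod_list (map (letter_val S) w)"

lemma adj_one: "adj S 1 = 1"
  by (metis adj_adj adj_mult mult_1 mult_1_right)

lemma adj_zero: "adj S 0 = 0"
  by (metis adj_add add_cancel_right_right)

lemma adj_power: "adj S (x ^ m) = adj S x ^ m"
  by (induction m) (simp_all add: adj_one adj_mult power_commutes)

lemma adj_rscl: "adj S (r \<cdot> x) = r \<cdot> adj S x"
  by (simp add: adj_scl)

text \<open>Summing over any finite set that contains the support makes evaluation visibly additive: for
  \<open>p + r\<close> the support may shrink by cancellation, but it stays within the union of the two supports.\<close>

lemma nc_eval_superset:
  assumes "finite A" "Poly_Mapping.keys p \<subseteq> A"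
  shows "nc_eval S p = (\<Sum>w\<in>A. scl S (Poly_Mapping.lookup p w) (word_val w))"
  unfolding nc_eval_def using assms
  by (intro sum.mono_neutral_left) (auto simp: in_keys_iff)

lemma nc_eval_add: "nc_eval S (p + r) = nc_eval S p + nc_eval S r"
proof -
  let ?A = "Poly_Mapping.keys p \<union> Poly_Mapping.keys r"
  have "nc_eval S t = (\<Sum>w\<in>?A. scl S (Poly_Mapping.lookup t w) (word_val w))"
    if "t \<in> {p, r, p + r}" for t
    using that keys_add[of p r] by (intro nc_eval_superset) auto
  then show ?thesis
    by (simp add: lookup_add vs.scale_left_distrib sum.distrib)
qed

lemma nc_eval_single: "nc_eval S (ncmon k w) = scl S k (word_val w)"
  by (subst nc_eval_superset[of "{w}"]) auto

lemma nc_eval_diff: "nc_eval S (p - r) = nc_eval S p - nc_eval S r"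
  using nc_eval_add[of "p - r" r] by simp

lemma sandwich_empty_words: "sandwich 1 [] p [] = p"
proof (rule poly_mapping_eqI)
  fix w
  have "Poly_Mapping.lookup (sandwich 1 [] p []) w
      = (\<Sum>v\<in>Poly_Mapping.keys p. if v = w then Poly_Mapping.lookup p v else 0)"
    unfolding sandwich_def by (simp add: lookup_sum lookup_single when_def)
  also have "\<dots> = Poly_Mapping.lookup p w"
    by (simp add: sum.delta' in_keys_iff)
  finally show "Poly_Mapping.lookup (sandwich 1 [] p []) w = Poly_Mapping.lookup p w" .
qed

text \<open>A relator is its own sandwich between empty words, so it lies in the ideal that is the kernel of
  evaluation. The relations between the generators are read off from this.\<close>

lemma nc_eval_relator:
  assumes "r \<in> relators q"
  shows "nc_eval S r = 0"
  using relation_ideal.step[OF relation_ideal.zero assms, of 1 "[]" "[]"]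
  by (simp add: presented sandwich_empty_words)

lemma a_c: "gen_a S * gen_c S = q \<cdot> (gen_c S * gen_a S)"
  using nc_eval_relator[of "ncmon 1 [La, Lc] - ncmon q [Lc, La]"]
  by (simp add: relators_def nc_eval_diff nc_eval_single)

lemma cs_as: "adj S (gen_c S) * adj S (gen_a S) = q \<cdot> (adj S (gen_a S) * adj S (gen_c S))"
  using nc_eval_relator[of "ncmon 1 [Lcs, Las] - ncmon q [Las, Lcs]"]
  by (simp add: relators_def nc_eval_diff nc_eval_single)

lemma as_a: "adj S (gen_a S) * gen_a S + adj S (gen_c S) * gen_c S = 1"
  using nc_eval_relator[of "ncmon 1 [Las, La] + ncmon 1 [Lcs, Lc] - ncmon 1 []"]
  by (simp add: relators_def nc_eval_diff nc_eval_add nc_eval_single)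

lemma a_as: "gen_a S * adj S (gen_a S) + q\<^sup>2 \<cdot> (gen_c S * adj S (gen_c S)) = 1"
  using nc_eval_relator[of "ncmon 1 [La, Las] + ncmon (q\<^sup>2) [Lc, Lcs] - ncmon 1 []"]
  by (simp add: relators_def nc_eval_diff nc_eval_add nc_eval_single)

text \<open>The algebra is spanned by the words in the generators, so a property that is stable under linear
  combinations can be proved by prepending one letter at a time.\<close>

lemma word_induct [case_names zero add scl one letter]:
  assumes "P 0" and add: "\<And>x y. P x \<Longrightarrow> P y \<Longrightarrow> P (x + y)"
    and scl: "\<And>k x. P x \<Longrightarrow> P (scl S k x)"
    and "P 1" and "\<And>l x. P x \<Longrightarrow> P (letter_val S l * x)"
  shows "P x"
proof -
  have word: "P (word_val w)" for w
    by (induction w) (simp_all add: assms)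
  have "P (\<Sum>w\<in>A. scl S (f w) (word_val w))" if "finite A" for A f
    using that by induction (simp_all add: assms(1) add scl word)
  with generated[of x] show ?thesis
    by (metis finite_keys nc_eval_def)
qed

end


section \<open>A $q$-binomial resolution of the identity\<close>

text \<open>The Gaussian binomial coefficient with base \<open>p\<close>, written as a product of \<open>k\<close> ratios as in the
  coefficients \<open>alpha\<close> and \<open>beta\<close>.\<close>

definition qbinom :: "real \<Rightarrow> nat \<Rightarrow> nat \<Rightarrow> real" where
  "qbinom p n k = (\<Prod>j<k. (1 - p ^ (n - j)) / (1 - p ^ Suc j))"

lemma qbinom_0 [simp]: "qbinom p n 0 = 1"
  by (simp add: qbinom_def)

lemma qbinom_Suc_self [simp]: "qbinom p n (Suc n) = 0"
  by (simp add: qbinom_def)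

text \<open>With the common factor $\prod_{j<k}(1-p^{n-j})/(1-p^{j+1})$ taken out and denominators cleared, Pascal's
  rule is
  $1-p^{n+1} = (1-p^{n-k}) + p^{n-k}(1-p^{k+1})$.\<close>

lemma qbinom_pascal:
  assumes p: "0 < p" "p \<noteq> 1" and "k \<le> n"
  shows "qbinom p (Suc n) (Suc k) = qbinom p n (Suc k) + p ^ (n - k) * qbinom p n k"
proof -
  let ?B = "\<Prod>j<k. 1 - p ^ Suc j"
  let ?A = "\<Prod>j<k. 1 - p ^ (n - j)"
  have "1 - p ^ Suc k \<noteq> 0"
    using p by (metis eq_iff_diff_eq_0 power_eq_1_iff real_norm_def abs_of_pos nat.distinct(1))
  have split: "qbinom p n k = ?A / ?B"
    "qbinom p n (Suc k) = ?A / ?B * ((1 - p ^ (n - k)) / (1 - p ^ Suc k))"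
    by (simp_all add: qbinom_def prod_dividef)
  have "(\<Prod>j<Suc k. 1 - p ^ (Suc n - j)) = (1 - p ^ Suc n) * ?A"
    by (simp add: prod.lessThan_Suc_shift del: prod.lessThan_Suc)
  then have "qbinom p (Suc n) (Suc k) = ?A / ?B * ((1 - p ^ Suc n) / (1 - p ^ Suc k))"
    by (simp add: qbinom_def prod_dividef)
  also have "1 - p ^ Suc n = (1 - p ^ (n - k)) + p ^ (n - k) * (1 - p ^ Suc k)"
    using \<open>k \<le> n\<close> by (simp add: algebra_simps flip: power_add power_Suc)
  finally show ?thesis
    using \<open>1 - p ^ Suc k \<noteq> 0\<close> by (simp add: split add_divide_distrib distrib_left)
qed

lemma qbinom_nonneg:
  assumes "0 < p"
  shows "0 \<le> qbinom p n k"
proof (cases "p \<le> 1")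
  case True
  then show ?thesis
    unfolding qbinom_def using assms
    by (intro prod_nonneg) (auto intro!: divide_nonneg_nonneg simp del: power_Suc simp: power_le_one)
next
  case False
  then show ?thesis
    unfolding qbinom_def
    by (intro prod_nonneg) (auto intro!: divide_nonpos_nonpos simp del: power_Suc)
qed

text \<open>A $q$-analogue of $1 = (xx'+t\,yy')^n$, by induction on \<open>n\<close>. From
  $1 = x\,1\,x' + t\,y\,1\,y'$ the inner \<open>1\<close> is expanded by the induction hypothesis. Enclosing
  $x^m y^k y'^k x'^m$ in $x \cdots x'$ raises \<open>m\<close>; enclosing it in $y \cdots y'$ raises \<open>k\<close> at the cost
  of a factor $r^{2m}$, since \<open>y\<close> and \<open>y'\<close> each pass \<open>m\<close> letters. Collecting terms with $m=n-k$ is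
  Pascal's rule in base $r^2$.

  This form covers both signs of the degree: $(x,y)=(a,c)$, $t=q^2$, $r=q^{-1}$ for $n\ge 0$, and
  $(x,y)=(a^*,c^*)$, $t=1$, $r=q$ for $n\le 0$.\<close>

lemma (in algebra_SUq2) qbinomial_resolution_of_one:
  assumes rel: "x * x' + t \<cdot> (y * y') = 1"
    and yx: "y * x = r \<cdot> (x * y)" and xy': "x' * y' = r \<cdot> (y' * x')"
    and r: "0 < r" "r \<noteq> 1"
  shows "(\<Sum>k\<le>n. (t ^ k * qbinom (r\<^sup>2) n k) \<cdot> (x ^ (n - k) * y ^ k * y' ^ k * x' ^ (n - k))) = 1"
proof (induction n)
  case 0
  then show ?case by simp
next
  case (Suc n)
  let ?T = "\<lambda>m k. x ^ m * y ^ k * y' ^ k * x' ^ m"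
  define c where "c n k = t ^ k * qbinom (r\<^sup>2) n k" for n k
  have r2: "0 < r\<^sup>2" "r\<^sup>2 \<noteq> 1"
    using r by (auto simp: power2_eq_1_iff)
  have c_Suc: "c (Suc n) (Suc k) = c n (Suc k) + t * c n k * (r\<^sup>2) ^ (n - k)" if "k \<le> n" for k
    unfolding c_def qbinom_pascal[OF r2 that] by (simp add: algebra_simps)
  have yxm: "y * x ^ m = r ^ m \<cdot> (x ^ m * y)" for m
  proof (induction m)
    case (Suc m)
    have "y * x ^ Suc m = r \<cdot> (x * (y * x ^ m))"
      by (metis power_Suc mult.assoc yx scl_mult_left)
    then show ?case
      by (simp add: Suc scl_mult_right mult.assoc)
  qed simp
  have xmy': "x' ^ m * y' = r ^ m \<cdot> (y' * x' ^ m)" for m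
  proof (induction m)
    case (Suc m)
    have "x' ^ Suc m * y' = r \<cdot> ((x' ^ m * y') * x')"
      by (metis power_Suc2 mult.assoc xy' scl_mult_right)
    then show ?case
      by (simp add: Suc scl_mult_left mult.assoc power_commutes)
  qed simp
  \<comment> \<open>The two ways to enclose a term; they add up to the induction step.\<close>
  have shift_x: "x * ?T m k * x' = ?T (Suc m) k" for m k
    by (simp add: mult.assoc power_commutes)
  have shift_y: "y * ?T m k * y' = (r\<^sup>2) ^ m \<cdot> ?T m (Suc k)" for m k
  proof -
    have "y * ?T m k * y' = (y * x ^ m) * y ^ k * y' ^ k * (x' ^ m * y')"
      by (simp add: mult.assoc)
    also have "\<dots> = (r ^ m * r ^ m) \<cdot> (x ^ m * (y * y ^ k) * (y' ^ k * y') * x' ^ m)"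
      unfolding yxm xmy' by (simp add: scl_mult_left scl_mult_right mult.assoc)
    finally show ?thesis
      by (simp add: power_commutes power2_eq_square power_mult_distrib)
  qed
  have "1 = x * 1 * x' + t \<cdot> (y * 1 * y')"
    using rel by simp
  also have "\<dots> = (\<Sum>k\<le>n. c n k \<cdot> (x * ?T (n - k) k * x'))
      + (\<Sum>k\<le>n. (t * c n k) \<cdot> (y * ?T (n - k) k * y'))"
    unfolding Suc.IH[symmetric] c_def
    by (simp add: sum_distrib_left sum_distrib_right vs.scale_sum_right scl_mult_left scl_mult_right mult.assoc)
  also have "\<dots> = (\<Sum>k\<le>n. c n k \<cdot> ?T (Suc n - k) k)
      + (\<Sum>k\<le>n. (t * c n k * (r\<^sup>2) ^ (n - k)) \<cdot> ?T (n - k) (Suc k))"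
    unfolding shift_x shift_y by (simp add: Suc_diff_le mult.assoc)
  also have "(\<Sum>k\<le>n. c n k \<cdot> ?T (Suc n - k) k) = (\<Sum>k\<le>Suc n. c n k \<cdot> ?T (Suc n - k) k)"
    by (simp add: c_def)
  also have "\<dots> = ?T (Suc n) 0 + (\<Sum>k\<le>n. c n (Suc k) \<cdot> ?T (n - k) (Suc k))"
    by (subst sum.atMost_Suc_shift) (simp add: c_def)
  also have "\<dots> + (\<Sum>k\<le>n. (t * c n k * (r\<^sup>2) ^ (n - k)) \<cdot> ?T (n - k) (Suc k))
      = ?T (Suc n) 0 + (\<Sum>k\<le>n. c (Suc n) (Suc k) \<cdot> ?T (n - k) (Suc k))"
    by (simp add: c_Suc vs.scale_left_distrib sum.distrib add.assoc)
  also have "\<dots> = (\<Sum>k\<le>Suc n. c (Suc n) k \<cdot> ?T (Suc n - k) k)"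
    by (subst sum.atMost_Suc_shift) (simp add: c_def)
  finally show ?case
    by (simp add: c_def)
qed


section \<open>Degrees\<close>

sublocale hopf_action_SUq2 \<subseteq> K: Vector_Spaces.linear "scl S" "scl S" "actK S"
  by (rule K_linear)
sublocale hopf_action_SUq2 \<subseteq> E: Vector_Spaces.linear "scl S" "scl S" "actE S"
  by (rule E_linear)
sublocale hopf_action_SUq2 \<subseteq> F: Vector_Spaces.linear "scl S" "scl S" "actF S"
  by (rule F_linear)

text \<open>For these values of the parameter the coefficients under the square roots are nonnegative,
  and \<open>K\<close> separates the degrees, so that \<open>X_z\<close> has a nonzero eigenvalue in every
  degree other than \<open>0\<close>.\<close>

locale quantum_hopf_bundle = hopf_action_SUq2 +
  assumes q_pos: "0 < q" and q_less_one: "q < 1"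
begin

abbreviation line :: "int \<Rightarrow> 'a set" where "line \<equiv> line0 q S"

lemma K_on_line: "x \<in> line n \<Longrightarrow> actK S x = q powr (n / 2) \<cdot> x"
  by (simp add: line0_def)

lemma line_zero: "0 \<in> line n"
  by (simp add: line0_def K.zero)

lemma line_one: "1 \<in> line 0"
  using q_pos by (simp add: line0_def K_one)

lemma line_scl: "x \<in> line n \<Longrightarrow> scl S k x \<in> line n"
  by (simp add: line0_def K.scale mult.commute)

lemma line_add: "x \<in> line n \<Longrightarrow> y \<in> line n \<Longrightarrow> x + y \<in> line n"
  by (simp add: line0_def K.add vs.scale_right_distrib)

lemma line_diff: "x \<in> line n \<Longrightarrow> y \<in> line n \<Longrightarrow> x - y \<in> line n"
  by (simp add: line0_def K.diff vs.scale_right_diff_distrib)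

lemma line_sum: "(\<And>i. i \<in> A \<Longrightarrow> f i \<in> line n) \<Longrightarrow> sum f A \<in> line n"
  by (induction A rule: infinite_finite_induct) (auto simp: line_zero line_add)

lemma line_mult:
  assumes "x \<in> line m" "y \<in> line n" "k = m + n"
  shows "x * y \<in> line k"
proof -
  have "q powr (n / 2) * q powr (m / 2) = q powr (k / 2)"
    by (simp add: assms(3) add.commute add_divide_distrib flip: powr_add)
  then show ?thesis
    using assms(1,2) by (simp add: line0_def K_mult scl_mult_left scl_mult_right flip: of_real_mult)
qed

lemma line_power: "x \<in> line m \<Longrightarrow> x ^ k \<in> line (int k * m)"
  by (induction k) (auto simp: line_one intro!: line_mult simp: algebra_simps)

lemma line_generators:
  "gen_a S \<in> line (-1)" "gen_c S \<in> line (-1)" "adj S (gen_a S) \<in> line 1" "adj S (gen_c S) \<in> line 1"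
  by (simp_all add: line0_def K_a K_c K_a_adj K_c_adj)

lemma Psi_line:
  "Psi q S n \<mu> \<in> line n" and adj_Psi_line: "adj S (Psi q S n \<mu>) \<in> line (-n)"
  using line_power[OF line_generators(1)] line_power[OF line_generators(2)]
    line_power[OF line_generators(3)] line_power[OF line_generators(4)]
  by (auto simp: Psi_def adj_zero adj_rscl adj_mult adj_power adj_adj line_zero
      intro!: line_scl line_mult)

lemma Kpow_mult: "(actK S ^^ k) (x * y) = (actK S ^^ k) x * (actK S ^^ k) y"
  by (induction k) (simp_all add: K_mult)

lemma Kpow_scl: "(actK S ^^ k) (scl S r x) = scl S r ((actK S ^^ k) x)"
  by (induction k) (simp_all add: K.scale)

lemma Kpow_one: "(actK S ^^ k) 1 = 1"
  by (induction k) (simp_all add: K_one)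

lemma Kpow_on_line: "x \<in> line n \<Longrightarrow> (actK S ^^ k) x = q powr (k * n / 2) \<cdot> x"
proof (induction k)
  case (Suc k)
  have "q powr (k * n / 2) * q powr (n / 2) = q powr (Suc k * n / 2)"
    by (simp add: add_divide_distrib distrib_right add.commute flip: powr_add)
  with Suc show ?case
    by (simp add: K.scale K_on_line flip: of_real_mult)
qed (use q_pos in simp)

lemma Kpow_line: "x \<in> line n \<Longrightarrow> (actK S ^^ k) x \<in> line n"
  by (simp add: Kpow_on_line line_scl)

text \<open>For \<open>T\<close> equal to \<open>E\<close> or \<open>F\<close>, which are given on the generators and on products only, the
  commutation relation with \<open>K\<close> is checked on the letters and carried along words: in
  $T(lx) = T(l)\,K(x) + K^{-1}(l)\,T(x)$ both sides of the relation pick up the same twists.\<close>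

lemma K_twisted_derivation:
  assumes lin: "Vector_Spaces.linear (scl S) (scl S) T"
    and one: "T 1 = 0"
    and mult: "\<And>x y. T (x * y) = T x * actK S y + actKinv S x * T y"
    and letter: "\<And>l. actK S (T (letter_val S l)) = s \<cdot> T (actK S (letter_val S l))"
  shows "actK S (T x) = s \<cdot> T (actK S x)"
proof -
  interpret T: Vector_Spaces.linear "scl S" "scl S" T by (rule lin)
  show ?thesis
  proof (induction x rule: word_induct)
    case (letter l x)
    have "actK S (T (letter_val S l * x)) =
        s \<cdot> T (actK S (letter_val S l)) * actK S (actK S x) + letter_val S l * (s \<cdot> T (actK S x))"
      by (simp add: mult K.add K_mult K_Kinv assms(4) letter)
    also have "\<dots> = s \<cdot> T (actK S (letter_val S l * x))"
      by (simp add: mult K_mult Kinv_K scl_mult_left scl_mult_right vs.scale_right_distrib)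
    finally show ?case .
  qed (simp_all add: K.zero T.zero K.add T.add K.scale T.scale K_one one vs.scale_right_distrib
      mult.commute)
qed

lemma powr_half_eqs: "q powr (1/2) = q * q powr - (1/2)" "q powr - (1/2) = inverse q * q powr (1/2)"
  using q_pos powr_add[of q 1 "-1/2"] powr_add[of q "-1" "1/2"] by (simp_all add: powr_minus)

lemma K_E: "actK S (actE S x) = q \<cdot> actE S (actK S x)"
proof (rule K_twisted_derivation[OF E_linear E_one E_mult])
  show "actK S (actE S (letter_val S l)) = q \<cdot> actE S (actK S (letter_val S l))" for l
    by (cases l) (simp_all add: E_a E_c E_a_adj E_c_adj K_a K_c K_a_adj K_c_adj K.scale K.neg E.scale K.zero
        powr_half_eqs(1) mult.commute)
qed

lemma K_F: "actK S (actF S x) = inverse q \<cdot> actF S (actK S x)"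
proof (rule K_twisted_derivation[OF F_linear F_one F_mult])
  show "actK S (actF S (letter_val S l)) = inverse q \<cdot> actF S (actK S (letter_val S l))" for l
    by (cases l) (simp_all add: F_a F_c F_a_adj F_c_adj K_a K_c K_a_adj K_c_adj K.scale K.neg F.scale K.zero
        powr_half_eqs(2) mult.commute del: of_real_inverse)
qed

section \<open>The vector fields and the differential\<close>

lemma X_plus_line: "x \<in> line n \<Longrightarrow> X_plus q S x \<in> line (n + 2)"
proof -
  assume x: "x \<in> line n"
  have "q * q powr (n / 2) = q powr ((n + 2) / 2)"
    using q_pos powr_add[of q 1 "n / 2"] by (simp add: add_divide_distrib add.commute)
  then have "actE S x \<in> line (n + 2)"
    by (simp add: line0_def K_E K_on_line[OF x] E.scale flip: of_real_mult)
  then show ?thesis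
    by (simp add: X_plus_def K_on_line[OF x] E.scale line_scl)
qed

lemma X_minus_line: "x \<in> line n \<Longrightarrow> X_minus q S x \<in> line (n - 2)"
proof -
  assume x: "x \<in> line n"
  have "inverse q * q powr (n / 2) = q powr ((n - 2) / 2)"
    using q_pos powr_add[of q "-1" "n / 2"] by (simp add: diff_divide_distrib powr_minus)
  then have "actF S x \<in> line (n - 2)"
    by (simp add: line0_def K_F K_on_line[OF x] F.scale flip: of_real_mult of_real_inverse)
  then show ?thesis
    by (simp add: X_minus_def K_on_line[OF x] F.scale line_scl)
qed

text \<open>On elements of degree \<open>n\<close> the operator $K^4$ is $q^{2n}$, so \<open>X_z\<close> acts there by this scalar.\<close>

definition X_z_eigenvalue :: "int \<Rightarrow> real" where
  "X_z_eigenvalue n = (1 - q powr (2 * n)) / (1 - q powi (-2))"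

lemma X_z_on_line: "x \<in> line n \<Longrightarrow> X_z q S x = X_z_eigenvalue n \<cdot> x"
  by (simp add: X_z_def X_z_eigenvalue_def Kpow_on_line vs.scale_left_diff_distrib algebra_simps
      diff_divide_distrib)

lemma X_z_eigenvalue_eq_0_iff: "X_z_eigenvalue n = 0 \<longleftrightarrow> n = 0"
proof -
  have "q powi (-2) \<noteq> 1"
    using q_pos q_less_one by (simp add: power_int_minus power2_eq_1_iff)
  moreover have "q powr (2 * n) = 1 \<longleftrightarrow> n = 0"
    using q_pos q_less_one by (simp add: powr_eq_one_iff_gen)
  ultimately show ?thesis
    by (simp add: X_z_eigenvalue_def)
qed

lemma rmul_rmul: "rmul S (rmul S \<eta> x) y = rmul S \<eta> (x * y)"
  by (cases \<eta>) (simp add: Kpow_mult mult.assoc del: funpow.simps)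

lemma rmul_lmul: "rmul S (lmul x \<eta>) y = lmul x (rmul S \<eta> y)"
  by (cases \<eta>) (simp add: mult.assoc)

lemma rmul_add_left: "rmul S (\<eta> + \<theta>) x = rmul S \<eta> x + rmul S \<theta> x"
  by (cases \<eta>; cases \<theta>) (simp add: distrib_right)

lemma Kpow_add: "(actK S ^^ k) (x + y) = (actK S ^^ k) x + (actK S ^^ k) y"
  by (induction k) (simp_all add: K.add)

lemma Kpow_zero: "(actK S ^^ k) 0 = 0"
  by (induction k) (simp_all add: K.zero)

lemma rmul_add_right: "rmul S \<eta> (x + y) = rmul S \<eta> x + rmul S \<eta> y"
  by (cases \<eta>) (simp add: Kpow_add distrib_left)

lemma rmul_zero_left: "rmul S 0 x = 0"
  by (simp add: zero_prod_def)

lemma rmul_zero_right: "rmul S \<eta> 0 = 0"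
  by (cases \<eta>) (simp add: zero_prod_def Kpow_zero)

lemma rmul_one: "rmul S \<eta> 1 = \<eta>"
  by (cases \<eta>) (simp add: Kpow_one)

lemma rmul_sum_left: "rmul S (sum f A) x = (\<Sum>i\<in>A. rmul S (f i) x)"
  by (induction A rule: infinite_finite_induct) (auto simp: rmul_zero_left rmul_add_left)

lemma rmul_sum_right: "rmul S \<eta> (sum f A) = (\<Sum>i\<in>A. rmul S \<eta> (f i))"
  by (induction A rule: infinite_finite_induct) (auto simp: rmul_zero_right rmul_add_right)

lemma rmul_scl_form: "rmul S (scl_form S k \<eta>) x = scl_form S k (rmul S \<eta> x)"
  by (cases \<eta>) (simp add: scl_mult_left)

lemma lmul_add_right: "lmul x (\<eta> + \<theta>) = lmul x \<eta> + lmul x \<theta>"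
  by (cases \<eta>; cases \<theta>) (simp add: distrib_left)

lemma lmul_lmul: "lmul x (lmul y \<eta>) = lmul (x * y) \<eta>"
  by (cases \<eta>) (simp add: mult.assoc)

lemma lmul_sum_right: "lmul x (sum f A) = (\<Sum>i\<in>A. lmul x (f i))"
  by (induction A rule: infinite_finite_induct) (auto simp: lmul_add_right, simp_all add: zero_prod_def)

lemma d_eq: "d q S x = (X_plus q S x, X_minus q S x, X_z q S x)"
  by (simp add: d_def om_plus_def om_minus_def om_z_def)

lemma d_add: "d q S (x + y) = d q S x + d q S y"
  by (simp add: d_eq X_plus_def X_minus_def X_z_def K.add E.add F.add Kpow_add
      vs.scale_right_distrib vs.scale_right_diff_distrib del: funpow.simps)

lemma d_scl: "d q S (scl S k x) = scl_form S k (d q S x)"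
  by (simp add: d_eq X_plus_def X_minus_def X_z_def K.scale E.scale F.scale Kpow_scl
      vs.scale_right_diff_distrib mult.commute)

text \<open>The two twists in the coproducts match the bimodule structure: after precomposition with \<open>K\<close> the
  operators $E$, $F$ satisfy $EK(xy) = EK(x)\,K^2(y) + x\,EK(y)$, and $K^2$ is the twist by which
  $\omega_\pm$ passes \<open>y\<close>. Likewise $xy-K^4(xy) = (x-K^4x)K^4(y)+x(y-K^4y)$.\<close>

lemma d_mult: "d q S (x * y) = rmul S (d q S x) y + lmul x (d q S y)"
proof -
  have "X_plus q S (x * y) = X_plus q S x * (actK S ^^ 2) y + x * X_plus q S y"
    by (simp add: X_plus_def K_mult E_mult Kinv_K vs.scale_right_distrib scl_mult_left scl_mult_right
        numeral_2_eq_2)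
  moreover have "X_minus q S (x * y) = X_minus q S x * (actK S ^^ 2) y + x * X_minus q S y"
    by (simp add: X_minus_def K_mult F_mult Kinv_K vs.scale_right_distrib scl_mult_left scl_mult_right
        numeral_2_eq_2)
  moreover have "X_z q S (x * y) = X_z q S x * (actK S ^^ 4) y + x * X_z q S y"
    by (simp add: X_z_def Kpow_mult scl_mult_left scl_mult_right algebra_simps
        flip: vs.scale_right_distrib vs.scale_right_diff_distrib)
  ultimately show ?thesis
    by (simp add: d_eq)
qed

section \<open>The frame of a line bundle\<close>

lemma beta_eq_qbinom:
  assumes "\<mu> \<le> nat n" "0 \<le> n"
  shows "beta q n \<mu> = (q\<^sup>2) ^ \<mu> * qbinom ((inverse q)\<^sup>2) (nat n) \<mu>"
proof -
  have pow: "q powi (-2 * int m) = ((inverse q)\<^sup>2) ^ m" for m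
    using q_pos by (simp add: power_int_mult power_int_minus power_inverse)
  have "q powi (-2 * (n - int j)) = ((inverse q)\<^sup>2) ^ (nat n - j)"
    "q powi (-2 * (int j + 1)) = ((inverse q)\<^sup>2) ^ Suc j" if "j < \<mu>" for j
    using that assms pow[of "nat n - j"] pow[of "Suc j"]
    by (simp_all add: of_nat_diff add.commute del: power_Suc)
  then show ?thesis
    unfolding beta_def qbinom_def by (simp add: power_mult del: power_Suc)
qed

lemma alpha_eq_qbinom: "alpha q n \<mu> = qbinom (q\<^sup>2) (nat \<bar>n\<bar>) (nat \<bar>n\<bar> - \<mu>)"
proof -
  have pow: "q powi (2 * int m) = (q\<^sup>2) ^ m" for m
    by (simp add: power_int_mult)
  have "q powi (2 * (\<bar>n\<bar> - int j)) = (q\<^sup>2) ^ (nat \<bar>n\<bar> - j)"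
    "q powi (2 * (int j + 1)) = (q\<^sup>2) ^ Suc j" if "j < nat \<bar>n\<bar> - \<mu>" for j
    using that pow[of "nat \<bar>n\<bar> - j"] pow[of "Suc j"]
    by (simp_all add: of_nat_diff add.commute del: power_Suc)
  then show ?thesis
    unfolding alpha_def qbinom_def by (simp del: power_Suc)
qed

text \<open>Term by term this is \<open>qbinomial_resolution_of_one\<close>. For negative \<open>n\<close> the entries of the
  column are numbered against the exponent of \<open>c\<close>, whence the reversal of the sum.\<close>

lemma Psi_normalized: "(\<Sum>\<mu>\<le>nat \<bar>n\<bar>. adj S (Psi q S n \<mu>) * Psi q S n \<mu>) = 1"
proof (cases "n \<ge> 0")
  case True
  let ?r = "inverse q" and ?N = "nat n"
  have "(\<Sum>\<mu>\<le>?N. ((q\<^sup>2) ^ \<mu> * qbinom (?r\<^sup>2) ?N \<mu>) \<cdot> (gen_a S ^ (?N - \<mu>) * gen_c S ^ \<mu>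
      * adj S (gen_c S) ^ \<mu> * adj S (gen_a S) ^ (?N - \<mu>))) = 1"
    by (rule qbinomial_resolution_of_one)
      (use a_as q_pos q_less_one in \<open>simp_all add: a_c cs_as flip: of_real_mult\<close>)
  moreover have "adj S (Psi q S n \<mu>) * Psi q S n \<mu> = ((q\<^sup>2) ^ \<mu> * qbinom (?r\<^sup>2) ?N \<mu>) \<cdot>
      (gen_a S ^ (?N - \<mu>) * gen_c S ^ \<mu> * adj S (gen_c S) ^ \<mu> * adj S (gen_a S) ^ (?N - \<mu>))"
    if "\<mu> \<le> ?N" for \<mu>
  proof -
    have "0 \<le> beta q n \<mu>"
      using q_pos True that qbinom_nonneg[of "?r\<^sup>2"] by (simp add: beta_eq_qbinom)
    then have "adj S (Psi q S n \<mu>) * Psi q S n \<mu> = beta q n \<mu> \<cdot>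
      (gen_a S ^ (?N - \<mu>) * gen_c S ^ \<mu> * adj S (gen_c S) ^ \<mu> * adj S (gen_a S) ^ (?N - \<mu>))"
      using that True by (simp add: Psi_def adj_rscl adj_mult adj_power adj_adj scl_mult_left
          scl_mult_right mult.assoc flip: of_real_mult)
    then show ?thesis
      using that True by (simp add: beta_eq_qbinom)
  qed
  ultimately show ?thesis
    using True by simp
next
  case False
  let ?N = "nat \<bar>n\<bar>"
  let ?f = "\<lambda>k. qbinom (q\<^sup>2) ?N k \<cdot> (adj S (gen_a S) ^ (?N - k) * adj S (gen_c S) ^ k
      * gen_c S ^ k * gen_a S ^ (?N - k))"
  have "(\<Sum>k\<le>?N. (1 ^ k * qbinom (q\<^sup>2) ?N k) \<cdot> (adj S (gen_a S) ^ (?N - k) * adj S (gen_c S) ^ k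
      * gen_c S ^ k * gen_a S ^ (?N - k))) = 1"
    by (rule qbinomial_resolution_of_one) (use as_a q_pos q_less_one in \<open>simp_all add: a_c cs_as\<close>)
  then have "sum ?f {..?N} = 1" by simp
  moreover have "adj S (Psi q S n \<mu>) * Psi q S n \<mu> = ?f (?N - \<mu>)" if "\<mu> \<le> ?N" for \<mu>
  proof -
    have "0 \<le> alpha q n \<mu>"
      using q_pos qbinom_nonneg[of "q\<^sup>2"] by (simp add: alpha_eq_qbinom)
    then have "adj S (Psi q S n \<mu>) * Psi q S n \<mu> = alpha q n \<mu> \<cdot>
      (adj S (gen_a S) ^ \<mu> * adj S (gen_c S) ^ (?N - \<mu>) * gen_c S ^ (?N - \<mu>) * gen_a S ^ \<mu>)"
      using that False by (simp add: Psi_def adj_rscl adj_mult adj_power adj_adj scl_mult_left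
          scl_mult_right mult.assoc flip: of_real_mult)
    then show ?thesis
      using that by (simp add: alpha_eq_qbinom)
  qed
  then have "(\<Sum>\<mu>\<le>?N. adj S (Psi q S n \<mu>) * Psi q S n \<mu>) = (\<Sum>\<mu>\<le>?N. ?f (?N - \<mu>))"
    by simp
  moreover have "(\<Sum>\<mu>\<le>?N. ?f (?N - \<mu>)) = sum ?f {..?N}"
    by (rule sum.reindex_bij_witness[of _ "\<lambda>k. ?N - k" "\<lambda>k. ?N - k"]) auto
  ultimately show ?thesis by metis
qed

section \<open>Horizontal forms\<close>

text \<open>The coefficients, with respect to $\omega_+,\omega_-,\omega_z$, of the horizontal coequivariant forms
  $\mathcal{L}^{(1)}_n$; the forms on the base are the case $n=0$.\<close>

definition line1 :: "int \<Rightarrow> 'a form1 set" where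
  "line1 n = {(u, v, w). u \<in> line (n + 2) \<and> v \<in> line (n - 2) \<and> w = 0}"

lemma base_forms_eq: "base_forms q S = line1 0"
  by (auto simp: base_forms_def line1_def om_plus_def om_minus_def)

lemma line1_zero: "0 \<in> line1 n"
  by (simp add: line1_def zero_prod_def line_zero)

lemma line1_add: "\<eta> \<in> line1 n \<Longrightarrow> \<theta> \<in> line1 n \<Longrightarrow> \<eta> + \<theta> \<in> line1 n"
  by (auto simp: line1_def line_add)

lemma line1_diff: "\<eta> \<in> line1 n \<Longrightarrow> \<theta> \<in> line1 n \<Longrightarrow> \<eta> - \<theta> \<in> line1 n"
  by (auto simp: line1_def line_diff)

lemma line1_sum: "(\<And>i. i \<in> A \<Longrightarrow> f i \<in> line1 n) \<Longrightarrow> sum f A \<in> line1 n"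
  by (induction A rule: infinite_finite_induct) (auto simp: line1_zero line1_add)

lemma line1_rmul: "\<eta> \<in> line1 m \<Longrightarrow> x \<in> line n \<Longrightarrow> k = m + n \<Longrightarrow> rmul S \<eta> x \<in> line1 k"
  by (auto simp: line1_def simp del: funpow.simps intro!: line_mult Kpow_line)

lemma line1_lmul: "x \<in> line m \<Longrightarrow> \<eta> \<in> line1 n \<Longrightarrow> k = m + n \<Longrightarrow> lmul x \<eta> \<in> line1 k"
  by (auto simp: line1_def intro!: line_mult)

lemma Psi_beyond: "nat \<bar>n\<bar> < \<mu> \<Longrightarrow> Psi q S n \<mu> = 0"
  by (simp add: Psi_def)

section \<open>Sections and the frame of a line bundle\<close>

text \<open>A section is recovered from its coefficients $\phi\,\Psi_\mu^*$, which are functions on the sphere: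
  the frame $\Psi_\mu$ generates the sections of degree \<open>n\<close> over the sphere algebra.\<close>

lemma line_frame: "(\<Sum>\<mu>\<le>nat \<bar>n\<bar>. \<phi> * adj S (Psi q S n \<mu>) * Psi q S n \<mu>) = \<phi>"
  using Psi_normalized[of n] by (simp add: mult.assoc flip: sum_distrib_left)

text \<open>The counterparts of \<open>times_ket\<close> on rows of functions and of \<open>times_bra\<close> on forms.\<close>

definition ket :: "int \<Rightarrow> (nat \<Rightarrow> 'a) \<Rightarrow> 'a" where
  "ket n \<sigma> = (\<Sum>\<mu>\<le>nat \<bar>n\<bar>. \<sigma> \<mu> * Psi q S n \<mu>)"

definition form_bra :: "int \<Rightarrow> 'a form1 \<Rightarrow> nat \<Rightarrow> 'a form1" where
  "form_bra n \<eta> = (\<lambda>\<mu>. rmul S \<eta> (adj S (Psi q S n \<mu>)))"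

lemma ket_times_bra: "ket n (times_bra q S n \<phi>) = \<phi>"
  by (simp add: ket_def times_bra_def line_frame)

lemma times_ket_form_bra: "times_ket q S n (form_bra n \<eta>) = \<eta>"
  by (simp add: times_ket_def form_bra_def rmul_rmul Psi_normalized rmul_one flip: rmul_sum_right)

lemma sphere_coefficients: "\<phi> \<in> line n \<Longrightarrow> \<phi> * adj S (Psi q S n \<mu>) \<in> line 0"
  by (rule line_mult[OF _ adj_Psi_line]) auto

text \<open>Multiplying a row by the projection is contracting it with the ket and multiplying by the bra, so the
  rows in \<open>E0\<close> are precisely those of the form $\phi\langle\Psi^{(n)}|$; such a row reproduces itself
  under the projection because the frame is normalized.\<close>

lemma E0_eq: "E0 q S n = times_bra q S n ` line n"
proof (intro equalityI subsetI)
  fix \<sigma> assume "\<sigma> \<in> E0 q S n"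
  then obtain v where v: "v \<in> rows n (line 0)"
    and \<sigma>: "\<sigma> = (\<lambda>\<nu>. \<Sum>\<mu>\<le>nat \<bar>n\<bar>. v \<mu> * proj q S n \<mu> \<nu>)"
    unfolding E0_def by blast
  have "\<sigma> = times_bra q S n (ket n v)"
    by (simp add: \<sigma> times_bra_def ket_def proj_def sum_distrib_right mult.assoc)
  moreover have "ket n v \<in> line n"
    unfolding ket_def by (intro line_sum line_mult[OF _ Psi_line]) (use v in \<open>auto simp: rows_def\<close>)
  ultimately show "\<sigma> \<in> times_bra q S n ` line n" by blast
next
  fix \<sigma> assume "\<sigma> \<in> times_bra q S n ` line n"
  then obtain \<phi> where \<phi>: "\<phi> \<in> line n" and \<sigma>: "\<sigma> = times_bra q S n \<phi>" by blast
  have "\<sigma> \<in> rows n (line 0)"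
    using sphere_coefficients[OF \<phi>] by (simp add: \<sigma> rows_def times_bra_def Psi_beyond adj_zero)
  moreover have "\<sigma> = (\<lambda>\<nu>. \<Sum>\<mu>\<le>nat \<bar>n\<bar>. \<sigma> \<mu> * proj q S n \<mu> \<nu>)"
  proof
    fix \<nu>
    have "(\<Sum>\<mu>\<le>nat \<bar>n\<bar>. \<sigma> \<mu> * proj q S n \<mu> \<nu>) = ket n \<sigma> * adj S (Psi q S n \<nu>)"
      by (simp add: ket_def proj_def sum_distrib_right mult.assoc)
    then show "\<sigma> \<nu> = (\<Sum>\<mu>\<le>nat \<bar>n\<bar>. \<sigma> \<mu> * proj q S n \<mu> \<nu>)"
      by (simp add: \<sigma> ket_times_bra) (simp add: times_bra_def)
  qed
  ultimately show "\<sigma> \<in> E0 q S n"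
    unfolding E0_def by blast
qed

lemma proj_rows: "(\<lambda>\<nu>. \<Sum>\<mu>\<le>nat \<bar>n\<bar>. rmul S (\<sigma> \<mu>) (proj q S n \<mu> \<nu>)) = form_bra n (times_ket q S n \<sigma>)"
  by (simp add: form_bra_def times_ket_def rmul_sum_left rmul_rmul proj_def)

lemma form_bra_in_E1: "\<eta> \<in> line1 n \<Longrightarrow> form_bra n \<eta> \<in> E1 q S n"
  unfolding E1_def proj_rows
  by (auto simp: rows_def base_forms_eq times_ket_form_bra)
    (auto simp: form_bra_def Psi_beyond adj_zero rmul_zero_right intro!: line1_rmul adj_Psi_line)

lemma form_bra_times_ket: "\<sigma> \<in> E1 q S n \<Longrightarrow> form_bra n (times_ket q S n \<sigma>) = \<sigma>"
  by (simp add: E1_def proj_rows)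

lemma times_ket_in_line1: "\<sigma> \<in> E1 q S n \<Longrightarrow> times_ket q S n \<sigma> \<in> line1 n"
  unfolding times_ket_def
  by (intro line1_sum line1_rmul[OF _ Psi_line]) (auto simp: E1_def rows_def base_forms_eq)

section \<open>Connections and the derivative \<open>D\<close>\<close>

definition connection_of :: "'a \<Rightarrow> 'a \<Rightarrow> 'a form1 \<Rightarrow> 'a form1" where
  "connection_of U V = (\<lambda>(u, v, w). (w * U, w * V, w))"

text \<open>Left linearity and the values on the basis forms determine a connection, and projection onto the
  multiples of $\omega_z+U\omega_++V\omega_-$ is one for every admissible \<open>U\<close>, \<open>V\<close>.\<close>

lemma connections_eq:
  "connections q S = {connection_of U V | U V. U \<in> line 2 \<and> V \<in> line (-2)}"
proof (intro equalityI subsetI)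
  fix P assume "P \<in> connections q S"
  then obtain U V where UV: "U \<in> line 2" "V \<in> line (-2)"
    and add: "\<And>\<eta> \<theta>. P (\<eta> + \<theta>) = P \<eta> + P \<theta>" and lmul: "\<And>x \<eta>. P (lmul x \<eta>) = lmul x (P \<eta>)"
    and P: "P om_plus = 0" "P om_minus = 0" "P om_z = om_z + lmul U om_plus + lmul V om_minus"
    unfolding connections_def by blast
  have "P \<eta> = connection_of U V \<eta>" for \<eta>
  proof (cases \<eta>)
    case (fields u v w)
    then have "\<eta> = lmul u om_plus + lmul v om_minus + lmul w om_z"
      by (simp add: om_plus_def om_minus_def om_z_def)
    then have "P \<eta> = lmul u (P om_plus) + lmul v (P om_minus) + lmul w (P om_z)"
      by (simp only: add lmul)
    then show ?thesis
      unfolding P by (simp add: fields connection_of_def zero_prod_def om_plus_def om_minus_def om_z_def)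
  qed
  then show "P \<in> {connection_of U V | U V. U \<in> line 2 \<and> V \<in> line (-2)}"
    using UV by blast
next
  fix P assume "P \<in> {connection_of U V | U V. U \<in> line 2 \<and> V \<in> line (-2)}"
  then show "P \<in> connections q S"
    by (auto simp: connections_def connection_of_def om_plus_def om_minus_def om_z_def zero_prod_def
        distrib_right mult.assoc)
qed

lemma D_connection_of:
  "D q S (connection_of U V) \<phi> = (X_plus q S \<phi> - X_z q S \<phi> * U, X_minus q S \<phi> - X_z q S \<phi> * V, 0)"
  by (simp add: D_def d_eq connection_of_def)

text \<open>The connection enters only through the vertical component \<open>X_z\<close>, which acts by a scalar: changing
  the connection changes \<open>D\<close> on degree \<open>n\<close> by right multiplication with a multiple of its 1-form.\<close>

lemma D_on_line:
  assumes "\<phi> \<in> line n"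
  shows "D q S (connection_of U V) \<phi>
    = D q S (connection_of 0 0) \<phi> - lmul \<phi> (X_z_eigenvalue n \<cdot> U, X_z_eigenvalue n \<cdot> V, 0)"
  by (simp add: D_connection_of X_z_on_line[OF assms] scl_mult_left scl_mult_right)

lemma D_in_line1:
  assumes "P \<in> connections q S" "\<phi> \<in> line n"
  shows "D q S P \<phi> \<in> line1 n"
proof -
  obtain U V where "U \<in> line 2" "V \<in> line (-2)" "P = connection_of U V"
    using assms(1) by (auto simp: connections_eq)
  then show ?thesis
    using assms(2)
    by (auto simp: line1_def D_connection_of X_z_on_line
        intro!: line_diff line_scl X_plus_line X_minus_line line_mult)
qed

lemma D_add: "P \<in> connections q S \<Longrightarrow> D q S P (\<phi> + \<psi>) = D q S P \<phi> + D q S P \<psi>"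
proof -
  assume "P \<in> connections q S"
  then have "P (d q S \<phi> + d q S \<psi>) = P (d q S \<phi>) + P (d q S \<psi>)"
    unfolding connections_def by blast
  then show ?thesis
    by (simp add: D_def d_add)
qed

lemma D_scl: "P \<in> connections q S \<Longrightarrow> D q S P (scl S k \<phi>) = scl_form S k (D q S P \<phi>)"
  using d_scl[of k \<phi>]
  by (auto simp: connections_eq D_connection_of d_eq scl_mult_left vs.scale_right_diff_distrib)

text \<open>The differential of a function on the base is horizontal, hence annihilated by the connection, and
  the Leibniz rule for \<open>d\<close> becomes the one for a covariant derivative.\<close>

lemma D_mult:
  assumes P: "P \<in> connections q S" and f: "f \<in> line 0"
  shows "D q S P (f * \<phi>) = rmul S (d q S f) \<phi> + lmul f (D q S P \<phi>)"
proof -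
  obtain U V where [simp]: "P = connection_of U V"
    using P by (auto simp: connections_eq)
  have "X_z q S f = 0"
    using X_z_on_line[OF f] X_z_eigenvalue_eq_0_iff[of 0] by simp
  then show ?thesis
    using d_mult[of f \<phi>] by (simp add: D_connection_of d_eq algebra_simps)
qed

section \<open>The correspondence\<close>

text \<open>The covariant derivative of the connection \<open>P\<close>: the derivative \<open>D\<close> transported along the
  isomorphisms from sections of degree \<open>n\<close> to rows.\<close>

definition cov_deriv_of :: "int \<Rightarrow> ('a form1 \<Rightarrow> 'a form1) \<Rightarrow> (nat \<Rightarrow> 'a) \<Rightarrow> (nat \<Rightarrow> 'a form1)" where
  "cov_deriv_of n P = (\<lambda>\<sigma>\<in>E0 q S n. form_bra n (D q S P (ket n \<sigma>)))"

lemma cov_deriv_of_times_bra: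
  "\<phi> \<in> line n \<Longrightarrow> cov_deriv_of n P (times_bra q S n \<phi>) = form_bra n (D q S P \<phi>)"
  by (simp add: cov_deriv_of_def E0_eq ket_times_bra)

lemma times_bra_add: "(\<lambda>\<mu>. times_bra q S n \<phi> \<mu> + times_bra q S n \<psi> \<mu>) = times_bra q S n (\<phi> + \<psi>)"
  and times_bra_scl: "(\<lambda>\<mu>. scl S k (times_bra q S n \<phi> \<mu>)) = times_bra q S n (scl S k \<phi>)"
  and times_bra_mult: "(\<lambda>\<mu>. f * times_bra q S n \<phi> \<mu>) = times_bra q S n (f * \<phi>)"
  by (simp_all add: times_bra_def distrib_right scl_mult_left mult.assoc)

lemma cov_deriv_of_in_cov_derivs:
  assumes P: "P \<in> connections q S"
  shows "cov_deriv_of n P \<in> cov_derivs q S n"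
proof -
  have "cov_deriv_of n P \<in> E0 q S n \<rightarrow>\<^sub>E E1 q S n"
    unfolding cov_deriv_of_def
    by (auto simp: E0_eq ket_times_bra intro!: form_bra_in_E1 D_in_line1[OF P])
  moreover have "f * \<phi> \<in> line n" if "f \<in> line 0" "\<phi> \<in> line n" for f \<phi>
    using line_mult[OF that] by simp
  ultimately show ?thesis
    by (auto simp: cov_derivs_def E0_eq times_bra_add times_bra_scl times_bra_mult
        cov_deriv_of_times_bra line_add line_scl D_add[OF P] D_scl[OF P] D_mult[OF P])
      (auto simp: form_bra_def rmul_add_left rmul_scl_form rmul_rmul rmul_lmul times_bra_def fun_eq_iff)
qed

text \<open>The rows in \<open>E1\<close> are recovered from their contraction with the ket, so the values of a covariant
  derivative on the rows $\phi\langle\Psi^{(n)}|$ are fixed by the equation for \<open>D\<close>.\<close>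

lemma cov_deriv_of_eq_iff:
  assumes P: "P \<in> connections q S" and N: "N \<in> cov_derivs q S n"
  shows "cov_deriv_of n P = N \<longleftrightarrow>
    (\<forall>\<phi>\<in>line n. D q S P \<phi> = times_ket q S n (N (times_bra q S n \<phi>)))"
proof
  assume "cov_deriv_of n P = N"
  then show "\<forall>\<phi>\<in>line n. D q S P \<phi> = times_ket q S n (N (times_bra q S n \<phi>))"
    by (auto simp: cov_deriv_of_times_bra times_ket_form_bra)
next
  assume *: "\<forall>\<phi>\<in>line n. D q S P \<phi> = times_ket q S n (N (times_bra q S n \<phi>))"
  have N': "N \<in> E0 q S n \<rightarrow>\<^sub>E E1 q S n"
    using N by (simp add: cov_derivs_def)
  show "cov_deriv_of n P = N"
  proof (rule PiE_ext[OF _ N'])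
    show "cov_deriv_of n P \<in> E0 q S n \<rightarrow>\<^sub>E E1 q S n"
      using cov_deriv_of_in_cov_derivs[OF P] by (simp add: cov_derivs_def)
    fix \<sigma> assume \<sigma>: "\<sigma> \<in> E0 q S n"
    then obtain \<phi> where \<phi>: "\<phi> \<in> line n" "\<sigma> = times_bra q S n \<phi>"
      by (auto simp: E0_eq)
    have "N \<sigma> \<in> E1 q S n"
      using N' \<sigma> by blast
    then show "cov_deriv_of n P \<sigma> = N \<sigma>"
      using * \<phi> by (simp add: cov_deriv_of_times_bra form_bra_times_ket)
  qed
qed

text \<open>If two connections give the same derivative, then $\phi U = \phi U'$ and $\phi V=\phi V'$ for every
  section $\phi$, since $X_z$ acts on degree \<open>n\<close> by a nonzero scalar. Taking for $\phi$ the frame elements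
  $\Psi_\mu$ and contracting with $\Psi_\mu^*$ removes the factor.\<close>

lemma inj_on_cov_deriv_of:
  assumes "n \<noteq> 0"
  shows "inj_on (cov_deriv_of n) (connections q S)"
proof (rule inj_onI)
  fix P P' assume PP': "P \<in> connections q S" "P' \<in> connections q S"
    and eq: "cov_deriv_of n P = cov_deriv_of n P'"
  obtain U V U' V' where P: "P = connection_of U V" "P' = connection_of U' V'"
    using PP' by (auto simp: connections_eq)
  let ?k = "X_z_eigenvalue n"
  have k: "?k \<noteq> 0"
    using assms by (simp add: X_z_eigenvalue_eq_0_iff)
  have "D q S P \<phi> = D q S P' \<phi>" if "\<phi> \<in> line n" for \<phi>
    using that eq by (metis cov_deriv_of_times_bra times_ket_form_bra)
  then have *: "\<phi> * U = \<phi> * U'" "\<phi> * V = \<phi> * V'" if "\<phi> \<in> line n" for \<phi>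
    using that k by (auto simp: P D_connection_of X_z_on_line scl_mult_left)
  have eqI: "u = u'" if "\<And>\<phi>. \<phi> \<in> line n \<Longrightarrow> \<phi> * u = \<phi> * u'" for u u'
  proof -
    have "u = (\<Sum>\<mu>\<le>nat \<bar>n\<bar>. adj S (Psi q S n \<mu>) * (Psi q S n \<mu> * u))"
      using Psi_normalized[of n] by (simp flip: mult.assoc sum_distrib_right)
    also have "\<dots> = (\<Sum>\<mu>\<le>nat \<bar>n\<bar>. adj S (Psi q S n \<mu>) * (Psi q S n \<mu> * u'))"
      using that[OF Psi_line] by simp
    also have "\<dots> = u'"
      using Psi_normalized[of n] by (simp flip: mult.assoc sum_distrib_right)
    finally show ?thesis .
  qed
  show "P = P'"
    unfolding P using eqI[of U U'] eqI[of V V'] * by simp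
qed

text \<open>A map that is linear over the functions on the sphere is determined on the frame: expanding $\phi$ as
  $\sum_\mu (\phi\Psi_\mu^*)\Psi_\mu$ gives $M\phi = \sum_\mu \phi\Psi_\mu^* M\Psi_\mu$, and $\phi$ can be
  taken out of the sum. In particular \<open>M\<close> is right multiplication by a form.\<close>

lemma left_linear_is_multiplication:
  fixes M :: "'a \<Rightarrow> 'a form1"
  assumes add: "\<And>\<phi> \<psi>. \<phi> \<in> line n \<Longrightarrow> \<psi> \<in> line n \<Longrightarrow> M (\<phi> + \<psi>) = M \<phi> + M \<psi>"
    and mult: "\<And>f \<phi>. f \<in> line 0 \<Longrightarrow> \<phi> \<in> line n \<Longrightarrow> M (f * \<phi>) = lmul f (M \<phi>)"
    and \<phi>: "\<phi> \<in> line n"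
  shows "M \<phi> = lmul \<phi> (\<Sum>\<mu>\<le>nat \<bar>n\<bar>. lmul (adj S (Psi q S n \<mu>)) (M (Psi q S n \<mu>)))"
proof -
  have "M 0 = M 0 + M 0"
    using add[OF line_zero line_zero] by simp
  then have M0: "M 0 = 0"
    by (metis add_cancel_right_right)
  have M_sum: "M (sum f A) = (\<Sum>i\<in>A. M (f i))" if "\<And>i. i \<in> A \<Longrightarrow> f i \<in> line n" for f and A :: "nat set"
    using that by (induction A rule: infinite_finite_induct) (auto simp: M0 add line_sum)
  let ?f = "\<lambda>\<mu>. \<phi> * adj S (Psi q S n \<mu>)"
  have "?f \<mu> * Psi q S n \<mu> \<in> line n" for \<mu>
    by (rule line_mult[OF sphere_coefficients[OF \<phi>] Psi_line]) simp
  then have "M (\<Sum>\<mu>\<le>nat \<bar>n\<bar>. ?f \<mu> * Psi q S n \<mu>) = (\<Sum>\<mu>\<le>nat \<bar>n\<bar>. lmul (?f \<mu>) (M (Psi q S n \<mu>)))"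
    by (simp add: M_sum mult[OF sphere_coefficients[OF \<phi>] Psi_line])
  then show ?thesis
    by (simp add: line_frame lmul_sum_right lmul_lmul)
qed

text \<open>Two covariant derivatives differ by a map linear over the functions on the sphere. Comparing \<open>N\<close> with
  the derivative of the connection with $U=V=0$, the difference is therefore right multiplication by a
  form, which has degree \<open>0\<close> because frame and dual frame have opposite degrees; dividing it by the
  eigenvalue of \<open>X_z\<close> gives the required connection.\<close>

lemma surj_cov_deriv_of:
  assumes n: "n \<noteq> 0" and N: "N \<in> cov_derivs q S n"
  shows "\<exists>P\<in>connections q S. cov_deriv_of n P = N"
proof -
  let ?k = "X_z_eigenvalue n"
  let ?base = "connection_of 0 0"
  define L where "L \<phi> = times_ket q S n (N (times_bra q S n \<phi>))" for \<phi>
  define M where "M \<phi> = L \<phi> - D q S ?base \<phi>" for \<phi>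
  have k: "?k \<noteq> 0"
    using n by (simp add: X_z_eigenvalue_eq_0_iff)
  have P0: "?base \<in> connections q S"
    using line_zero by (auto simp: connections_eq)
  have NE1: "N (times_bra q S n \<phi>) \<in> E1 q S n" if "\<phi> \<in> line n" for \<phi>
    using N that by (auto simp: cov_derivs_def E0_eq)
  have L_add: "L (\<phi> + \<psi>) = L \<phi> + L \<psi>" if "\<phi> \<in> line n" "\<psi> \<in> line n" for \<phi> \<psi>
  proof -
    have "N (times_bra q S n (\<phi> + \<psi>)) = (\<lambda>\<mu>. N (times_bra q S n \<phi>) \<mu> + N (times_bra q S n \<psi>) \<mu>)"
      using N that by (auto simp: cov_derivs_def E0_eq times_bra_add)
    then show ?thesis
      by (simp add: L_def times_ket_def rmul_add_left sum.distrib)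
  qed
  \<comment> \<open>Contracting with the ket turns $\mathrm{d}f\,\langle\sigma_\phi|$ into $\mathrm{d}f\,\phi$.\<close>
  have L_mult: "L (f * \<phi>) = rmul S (d q S f) \<phi> + lmul f (L \<phi>)" if "f \<in> line 0" "\<phi> \<in> line n" for f \<phi>
  proof -
    have "N (times_bra q S n (f * \<phi>))
        = (\<lambda>\<mu>. rmul S (d q S f) (times_bra q S n \<phi> \<mu>) + lmul f (N (times_bra q S n \<phi>) \<mu>))"
      using N that by (auto simp: cov_derivs_def E0_eq times_bra_mult)
    then have "L (f * \<phi>) = rmul S (d q S f) (ket n (times_bra q S n \<phi>)) + lmul f (L \<phi>)"
      by (simp add: L_def times_ket_def ket_def rmul_add_left sum.distrib rmul_rmul rmul_lmul
          rmul_sum_right lmul_sum_right)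
    then show ?thesis
      by (simp add: ket_times_bra)
  qed
  have M_line1: "M \<phi> \<in> line1 n" if "\<phi> \<in> line n" for \<phi>
    unfolding M_def L_def by (intro line1_diff times_ket_in_line1 NE1 D_in_line1 P0 that)
  define m where "m = (\<Sum>\<mu>\<le>nat \<bar>n\<bar>. lmul (adj S (Psi q S n \<mu>)) (M (Psi q S n \<mu>)))"
  have M_mult: "M (f * \<phi>) = lmul f (M \<phi>)" if "f \<in> line 0" "\<phi> \<in> line n" for f \<phi>
    unfolding M_def L_mult[OF that] D_mult[OF P0 that(1)]
    by (cases "L \<phi>"; cases "D q S ?base \<phi>") (simp add: algebra_simps)
  have M_eq: "M \<phi> = lmul \<phi> m" if "\<phi> \<in> line n" for \<phi>
    unfolding m_def
  proof (rule left_linear_is_multiplication[OF _ M_mult that])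
    show "M (\<phi> + \<psi>) = M \<phi> + M \<psi>" if "\<phi> \<in> line n" "\<psi> \<in> line n" for \<phi> \<psi>
      using that by (simp add: M_def L_add D_add[OF P0])
  qed
  have "m \<in> line1 0"
    unfolding m_def by (intro line1_sum line1_lmul[OF adj_Psi_line M_line1[OF Psi_line]]) auto
  then obtain u v where m: "m = (u, v, 0)" and uv: "u \<in> line 2" "v \<in> line (-2)"
    by (auto simp: line1_def)
  \<comment> \<open>The 1-form of a connection enters \<open>D\<close> with a minus sign, which is compensated here.\<close>
  let ?P = "connection_of (- inverse ?k \<cdot> u) (- inverse ?k \<cdot> v)"
  have P: "?P \<in> connections q S"
    using uv by (auto simp: connections_eq intro!: exI line_scl simp del: of_real_minus of_real_inverse)
  have "D q S ?P \<phi> = L \<phi>" if "\<phi> \<in> line n" for \<phi>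
  proof -
    have "?k \<cdot> - inverse ?k \<cdot> x = - x" for x
      using k by simp
    then have "D q S ?P \<phi> = D q S ?base \<phi> - lmul \<phi> (- u, - v, 0)"
      using D_on_line[OF that] by metis
    also have "\<dots> = D q S ?base \<phi> + lmul \<phi> m"
      by (cases "D q S ?base \<phi>") (simp add: m)
    also have "\<dots> = L \<phi>"
      unfolding M_eq[OF that, symmetric] M_def by simp
    finally show ?thesis .
  qed
  then have "cov_deriv_of n ?P = N"
    unfolding cov_deriv_of_eq_iff[OF P N] L_def by blast
  with P show ?thesis by blast
qed

text \<open>In degree \<open>0\<close> all connections induce the derivative \<open>d\<close>, and there are at least two connections:
  the frame of degree \<open>2\<close> is normalized, so it has a nonzero entry, which can serve as \<open>U\<close>.\<close>

lemma not_inj_on_cov_deriv_of_0: "\<not> inj_on (cov_deriv_of 0) (connections q S)"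
proof
  assume inj: "inj_on (cov_deriv_of 0) (connections q S)"
  have eq: "cov_deriv_of 0 (connection_of U 0) = cov_deriv_of 0 (connection_of 0 0)" for U
  proof -
    have "D q S (connection_of U 0) \<phi> = D q S (connection_of 0 0) \<phi>" if "\<phi> \<in> line 0" for \<phi>
      using X_z_eigenvalue_eq_0_iff[of 0] by (simp add: D_connection_of X_z_on_line[OF that])
    then show ?thesis
      unfolding cov_deriv_of_def by (intro restrict_ext) (auto simp: E0_eq ket_times_bra)
  qed
  have "U = 0" if "U \<in> line 2" for U
  proof -
    have "connection_of U 0 = connection_of 0 0"
    proof (rule inj_onD[OF inj])
      show "cov_deriv_of 0 (connection_of U 0) = cov_deriv_of 0 (connection_of 0 0)"
        by (rule eq)
      show "connection_of U 0 \<in> connections q S" "connection_of 0 0 \<in> connections q S"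
        using that line_zero by (auto simp: connections_eq)
    qed
    then have "connection_of U 0 (0, 0, 1) = connection_of 0 0 (0, 0, 1)"
      by simp
    then show ?thesis
      by (simp add: connection_of_def)
  qed
  then have "Psi q S 2 \<mu> = 0" for \<mu>
    using Psi_line by blast
  then show False
    using Psi_normalized[of 2] by simp
qed

end

theorem proposition6p2:
  fixes q :: real and S :: "('a::ring_1) suq2" and n :: int
  assumes "0 < q" and "q < 1"
    and "hopf_action_SUq2 q S"
  shows "\<exists>G \<in> connections q S \<rightarrow> cov_derivs q S n.
    (\<forall>P\<in>connections q S. \<forall>N\<in>cov_derivs q S n.
       G P = N \<longleftrightarrow>
       (\<forall>\<phi>\<in>line0 q S n. D q S P \<phi> = times_ket q S n (N (times_bra q S n \<phi>)))) \<and>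
    (bij_betw G (connections q S) (cov_derivs q S n) \<longleftrightarrow> n \<noteq> 0)"
proof -
  interpret quantum_hopf_bundle q S
    using assms by (simp add: quantum_hopf_bundle_def quantum_hopf_bundle_axioms_def)
  have "bij_betw (cov_deriv_of n) (connections q S) (cov_derivs q S n)" if "n \<noteq> 0"
    unfolding bij_betw_def
  proof (intro conjI inj_on_cov_deriv_of[OF that] equalityI subsetI)
    show "N \<in> cov_deriv_of n ` connections q S" if "N \<in> cov_derivs q S n" for N
      using surj_cov_deriv_of[OF \<open>n \<noteq> 0\<close> that] by blast
  qed (auto intro: cov_deriv_of_in_cov_derivs)
  moreover have "\<not> bij_betw (cov_deriv_of n) (connections q S) (cov_derivs q S n)" if "n = 0"
    using not_inj_on_cov_deriv_of_0 by (simp add: that bij_betw_def)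
  ultimately show ?thesis
    by (intro bexI[of _ "cov_deriv_of n"]) (auto simp: cov_deriv_of_eq_iff cov_deriv_of_in_cov_derivs)
qed

end
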